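(* For every positive integer $t$ there are, up to isomorphism, only finitely many graphs that are planar, $P_t$-free, and $k$-vertex-critical for some positive integer $k$.
   Context: $P_t$ denotes the path on $t$ vertices; a graph is $P_t$-free if it contains no induced subgraph isomorphic to $P_t$. A $k$-coloring of $G$ is a map $V(G)\to\{1,\dots,k\}$ giving adjacent vertices different colors; $G$ is $k$-chromatic if it is $k$-colorable but not $(k-1)$-colorable. A graph $G$ is $k$-vertex-critical if it is $k$-chromatic and every proper induced subgraph of $G$ is $(k-1)$-colorable. *)

theory Defs
  imports "HOL-Analysis.Analysis"
begin

type_synonym 'a sgraph = "'a set \<times> 'a set set"

definition sgraph :: "'a sgraph \<Rightarrow> bool" where
  "sgraph G \<longleftrightarrow> finite (fst G) \<and>
     (\<forall>e\<in>snd G. \<exists>u v. u \<noteq> v \<and> u \<in> fst G \<and> v \<in> fst G \<and> e = {u, v})"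

definition adj :: "'a sgraph \<Rightarrow> 'a \<Rightarrow> 'a \<Rightarrow> bool" where
  "adj G u v \<longleftrightarrow> {u, v} \<in> snd G"

definition induced :: "'a sgraph \<Rightarrow> 'a set \<Rightarrow> 'a sgraph" where
  "induced G S = (S, {e \<in> snd G. e \<subseteq> S})"

definition colorable :: "'a sgraph \<Rightarrow> nat \<Rightarrow> bool" where
  "colorable G k \<longleftrightarrow> (\<exists>c :: 'a \<Rightarrow> nat. (\<forall>v\<in>fst G. c v \<in> {1..k}) \<and>
      (\<forall>u\<in>fst G. \<forall>v\<in>fst G. adj G u v \<longrightarrow> c u \<noteq> c v))"

definition chromatic :: "'a sgraph \<Rightarrow> nat \<Rightarrow> bool" where
  "chromatic G k \<longleftrightarrow> colorable G k \<and> \<not> colorable G (k - 1)"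

definition vertex_critical :: "'a sgraph \<Rightarrow> nat \<Rightarrow> bool" where
  "vertex_critical G k \<longleftrightarrow> chromatic G k \<and>
     (\<forall>S. S \<subset> fst G \<longrightarrow> colorable (induced G S) (k - 1))"

definition has_induced_path :: "nat \<Rightarrow> 'a sgraph \<Rightarrow> bool" where
  "has_induced_path t G \<longleftrightarrow> (\<exists>p :: nat \<Rightarrow> 'a. inj_on p {..<t} \<and> p ` {..<t} \<subseteq> fst G \<and>
      (\<forall>i<t. \<forall>j<t. adj G (p i) (p j) \<longleftrightarrow> (i = j + 1 \<or> j = i + 1)))"

definition Pt_free :: "nat \<Rightarrow> 'a sgraph \<Rightarrow> bool" where
  "Pt_free t G \<longleftrightarrow> \<not> has_induced_path t G"

definition graph_iso :: "'a sgraph \<Rightarrow> 'b sgraph \<Rightarrow> bool" where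
  "graph_iso G H \<longleftrightarrow> (\<exists>f. bij_betw f (fst G) (fst H) \<and>
      (\<forall>u\<in>fst G. \<forall>v\<in>fst G. adj G u v \<longleftrightarrow> adj H (f u) (f v)))"

definition planar :: "'a sgraph \<Rightarrow> bool" where
  "planar G \<longleftrightarrow> (\<exists>(pos :: 'a \<Rightarrow> real \<times> real) (\<gamma> :: 'a set \<Rightarrow> real \<Rightarrow> real \<times> real).
      inj_on pos (fst G) \<and>
      (\<forall>e\<in>snd G. arc (\<gamma> e) \<and> {pathstart (\<gamma> e), pathfinish (\<gamma> e)} = pos ` e \<and>
                  path_image (\<gamma> e) \<inter> pos ` fst G = pos ` e) \<and>
      (\<forall>e\<in>snd G. \<forall>e'\<in>snd G. e \<noteq> e' \<longrightarrow>
                  path_image (\<gamma> e) \<inter> path_image (\<gamma> e') \<subseteq> pos ` (e \<inter> e')))"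

end

theory Submission
  imports Defs
begin

text \<open>Let \<open>G\<close> be planar, \<open>P\<^sub>t\<close>-free and vertex-critical. By criticality, deleting two vertices \<open>a, b\<close> leaves
  at most four components, since a component is determined by whether its colourings can give \<open>a\<close> and \<open>b\<close>
  equal or different colours. In a component containing many vertices of a set \<open>U\<close>, a breadth-first
  search tree has depth less than \<open>t\<close>, so some vertex \<open>x\<close> has many children with descendants in \<open>U\<close>:
  short disjoint branches lead from \<open>x\<close> to a large subset of \<open>U\<close>. Three rounds, each time deleting the
  vertices found before, give \<open>x\<^sub>1, x\<^sub>2, x\<^sub>3\<close> with such branches to a common large set; as the branches are
  short, three of its elements have disjoint unions of branches, which form a \<open>K\<^sub>3\<^sub>,\<^sub>3\<close> minor. In the plane,
  this would yield three arcs from \<open>x\<^sub>1\<close> to \<open>x\<^sub>2\<close>, all of them touched by the face that contains \<open>x\<^sub>3\<close>, whereas every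
  face of a theta curve is bounded by two of its arcs only. Hence the order of \<open>G\<close> is bounded in terms of \<open>t\<close>.\<close>

section \<open>Theta curves\<close>

lemma connected_subset_inside:
  assumes "connected T" "T \<inter> S = {}" "T \<inter> inside S \<noteq> {}"
  shows "T \<subseteq> inside S"
proof
  fix y assume "y \<in> T"
  obtain x where "x \<in> T" "x \<in> inside S" using assms(3) by blast
  have "connected_component (- S) x y"
    unfolding connected_component_def using assms \<open>x \<in> T\<close> \<open>y \<in> T\<close> by blast
  then show "y \<in> inside S" using inside_same_component \<open>x \<in> inside S\<close> by metis
qed

lemma connected_insert_closure:
  assumes "connected W" "q \<in> closure W"
  shows "connected (insert q W)"
  using connected_intermediate_closure[of W "insert q W"] assms closure_subset[of W] by auto

text \<open>\<open>g3\<close> cuts the inside of the Jordan curve formed by \<open>g1\<close> and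
  \<open>g2\<close> into two domains. Being close to \<open>q3\<close> forces \<open>W\<close> into
  this inside, hence into one of the domains. Its boundary omits the interior of \<open>g1\<close>
  or of \<open>g2\<close>, so \<open>q1\<close> or \<open>q2\<close> would lie strictly inside the
  curve that it belongs to.\<close>

lemma no_common_face_inside:
  fixes g1 g2 g3 :: "real \<Rightarrow> complex"
  assumes arcs: "arc g1" "arc g2" "arc g3"
    and start: "pathstart g1 = a" "pathstart g2 = a" "pathstart g3 = a"
    and finish: "pathfinish g1 = b" "pathfinish g2 = b" "pathfinish g3 = b"
    and int: "path_image g1 \<inter> path_image g2 = {a,b}" "path_image g1 \<inter> path_image g3 = {a,b}"
      "path_image g2 \<inter> path_image g3 = {a,b}"
    and W: "connected W" "W \<inter> (path_image g1 \<union> path_image g2 \<union> path_image g3) = {}"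
    and cl: "q1 \<in> closure W" "q2 \<in> closure W" "q3 \<in> closure W"
    and q: "q1 \<in> path_image g1 - {a,b}" "q2 \<in> path_image g2 - {a,b}" "q3 \<in> path_image g3 - {a,b}"
    and ne: "path_image g3 \<inter> inside (path_image g1 \<union> path_image g2) \<noteq> {}"
  shows False
proof -
  have "a \<noteq> b" using arcs(1) start(1) finish(1) arc_distinct_ends by metis
  have sp: "simple_path g1" "simple_path g2" "simple_path g3"
    using arcs arc_imp_simple_path by auto
  have split: "inside (path_image g1 \<union> path_image g3) \<union> inside (path_image g2 \<union> path_image g3)
      \<union> (path_image g3 - {a,b}) = inside (path_image g1 \<union> path_image g2)"
    by (rule split_inside_simple_closed_curve
      [OF sp(1) start(1) finish(1) sp(2) start(2) finish(2) sp(3) start(3) finish(3) \<open>a \<noteq> b\<close> int ne])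
  have "W \<noteq> {}" using cl by auto
  have q12: "q3 \<in> inside (path_image g1 \<union> path_image g2)" using split q(3) by blast
  have "insert q3 W \<subseteq> inside (path_image g1 \<union> path_image g2)"
    by (rule connected_subset_inside[OF connected_insert_closure[OF W(1) cl(3)]])
      (use W(2) q(3) int q12 in auto)
  then have "W \<inter> inside (path_image g1 \<union> path_image g3) \<noteq> {} \<or>
      W \<inter> inside (path_image g2 \<union> path_image g3) \<noteq> {}"
    using split W(2) \<open>W \<noteq> {}\<close> by blast
  then show False
  proof
    assume "W \<inter> inside (path_image g1 \<union> path_image g3) \<noteq> {}"
    \<comment> \<open>\<open>q2\<close> is off the boundary of this domain, because
      \<open>g2\<close> meets \<open>g1\<close> and \<open>g3\<close> only at \<open>a\<close> and
      \<open>b\<close>.\<close>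
    then have "insert q2 W \<subseteq> inside (path_image g1 \<union> path_image g3)"
      by (intro connected_subset_inside[OF connected_insert_closure[OF W(1) cl(2)]])
        (use W(2) q(2) int in auto)
    then have "q2 \<in> inside (path_image g1 \<union> path_image g2)" using split by blast
    then show False using q(2) inside_no_overlap[of "path_image g1 \<union> path_image g2"] by blast
  next
    assume "W \<inter> inside (path_image g2 \<union> path_image g3) \<noteq> {}"
    then have "insert q1 W \<subseteq> inside (path_image g2 \<union> path_image g3)"
      by (intro connected_subset_inside[OF connected_insert_closure[OF W(1) cl(1)]])
        (use W(2) q(1) int in auto)
    then have "q1 \<in> inside (path_image g1 \<union> path_image g2)" using split by blast
    then show False using q(1) inside_no_overlap[of "path_image g1 \<union> path_image g2"] by blast
  qed
qed

section \<open>Turning a Jordan curve inside out\<close>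

text \<open>The image of the outside is connected and misses the image curve, so one point landing
  inside is enough. Without such a point the punctured inside of \<open>c\<close> would be mapped
  into the bounded inside of the image curve, but \<open>f\<close> is unbounded near
  \<open>z\<close>.\<close>

lemma inversion_outside_subset_inside:
  fixes c :: "real \<Rightarrow> complex"
  assumes c: "simple_path c" "pathfinish c = pathstart c" and z: "z \<in> inside (path_image c)"
  defines "f \<equiv> \<lambda>w. 1 / (w - z)"
  shows "f ` outside (path_image c) \<subseteq> inside (f ` path_image c)"
proof -
  let ?C = "path_image c"
  note J = Jordan_inside_outside[OF c]
  have zC: "z \<notin> ?C" "z \<notin> outside ?C"
    using z inside_no_overlap[of ?C] inside_Int_outside[of ?C] by blast+
  have cont: "continuous_on A f" if "z \<notin> A" for A
    unfolding f_def using that by (intro continuous_intros) auto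
  \<comment> \<open>Division by zero gives \<open>f z = 0\<close>, a value taken at no other point,
    so \<open>f\<close> is injective on the whole plane.\<close>
  have inj: "u = v" if "f u = f v" for u v
    using that by (simp add: f_def)
  have sp: "simple_path (f \<circ> c)"
    using c(1) inj cont[OF zC(1)] unfolding simple_path_def loop_free_def
    by (auto intro!: path_continuous_image dest!: inj)
  have "pathfinish (f \<circ> c) = pathstart (f \<circ> c)"
    using c(2) by (simp add: pathfinish_compose pathstart_compose)
  note J' = Jordan_inside_outside[OF sp this, unfolded path_image_compose]
  \<comment> \<open>A nonzero \<open>y\<close> is wanted, since 0 is only the default value at
    \<open>z\<close>. It exists because the inside is open and nonempty.\<close>
  have "inside (f ` ?C) \<noteq> {0}" using J' not_open_singleton by metis
  then obtain y where y: "y \<in> inside (f ` ?C)" "y \<noteq> 0" using J' by blast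
  define w where "w = 1 / y + z"
  have fw: "f w = y" "w \<noteq> z" using y(2) by (auto simp: f_def w_def)
  have "w \<notin> ?C" using fw(1) y(1) inside_no_overlap[of "f ` ?C"] by blast
  have w_out: "w \<in> outside ?C"
  proof (rule ccontr)
    assume "w \<notin> outside ?C"
    then have "w \<in> inside ?C" using \<open>w \<notin> ?C\<close> J by blast
    have "connected (inside ?C - {z})" using J by (intro connected_open_delete) auto
    then have "connected (f ` (inside ?C - {z}))" by (intro connected_continuous_image cont) auto
    moreover have "f ` (inside ?C - {z}) \<inter> f ` ?C = {}"
      using inside_no_overlap[of ?C] inj by blast
    moreover have "y \<in> f ` (inside ?C - {z}) \<inter> inside (f ` ?C)"
      using \<open>w \<in> inside ?C\<close> fw y by blast
    ultimately have "f ` (inside ?C - {z}) \<subseteq> inside (f ` ?C)"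
      using connected_subset_inside by blast
    moreover have "bounded (inside (f ` ?C))" using J' by blast
    ultimately have "bounded (f ` (inside ?C - {z}))" using bounded_subset by blast
    then obtain B where B: "B > 0" "\<And>x. x \<in> inside ?C - {z} \<Longrightarrow> norm (f x) \<le> B"
      unfolding bounded_pos by auto
    have "open (inside ?C)" using J by blast
    then obtain e where e: "e > 0" "ball z e \<subseteq> inside ?C" using z openE by blast
    \<comment> \<open>Small enough for \<open>z + d\<close> to stay in the ball, and for
      \<open>1 / d\<close> to be at least \<open>2 * B\<close>.\<close>
    define d where "d = min (e / 2) (1 / (2 * B))"
    have d: "d > 0" "d < e" "d \<le> 1 / (2 * B)" using e(1) B(1) by (auto simp: d_def)
    have "z + of_real d \<in> inside ?C - {z}" using d(1,2) e(2) by (auto simp: dist_norm subset_iff)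
    then have "norm (f (z + of_real d)) \<le> B" by (rule B(2))
    then have "1 / d \<le> B" using d(1) by (simp add: f_def norm_divide)
    then show False using d(1,3) B(1) by (auto simp: field_simps)
  qed
  show ?thesis
  proof (rule connected_subset_inside)
    show "connected (f ` outside ?C)" using J zC by (intro connected_continuous_image cont) auto
    show "f ` outside ?C \<inter> f ` ?C = {}"
      using outside_no_overlap[of ?C] inj by blast
    show "f ` outside ?C \<inter> inside (f ` ?C) \<noteq> {}" using w_out fw y by blast
  qed
qed

text \<open>Three arcs with common ends form a theta curve, and each of its faces has only two of
  the arcs on its boundary. Here \<open>W\<close> is a connected part of a face that comes close to
  inner points of all three.\<close>

lemma no_common_face:
  fixes g1 g2 g3 :: "real \<Rightarrow> complex"
  assumes arcs: "arc g1" "arc g2" "arc g3"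
    and start: "pathstart g1 = a" "pathstart g2 = a" "pathstart g3 = a"
    and finish: "pathfinish g1 = b" "pathfinish g2 = b" "pathfinish g3 = b"
    and int: "path_image g1 \<inter> path_image g2 = {a,b}" "path_image g1 \<inter> path_image g3 = {a,b}"
      "path_image g2 \<inter> path_image g3 = {a,b}"
    and W: "connected W" "W \<inter> (path_image g1 \<union> path_image g2 \<union> path_image g3) = {}"
    and cl: "q1 \<in> closure W" "q2 \<in> closure W" "q3 \<in> closure W"
    and q: "q1 \<in> path_image g1 - {a,b}" "q2 \<in> path_image g2 - {a,b}" "q3 \<in> path_image g3 - {a,b}"
  shows False
proof (cases "path_image g3 \<inter> inside (path_image g1 \<union> path_image g2) = {}")
  case False
  then show False using no_common_face_inside[OF assms] by blast
next
  \<comment> \<open>The inversion about a point inside the curve formed by \<open>g1\<close> and \<open>g2\<close> moves \<open>g3\<close> inside.\<close>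
  case True
  define c where "c = g1 +++ reversepath g2"
  have pc: "path_image c = path_image g1 \<union> path_image g2"
    unfolding c_def using start finish by (simp add: path_image_join)
  have c: "simple_path c" "pathfinish c = pathstart c"
    unfolding c_def using arcs start finish int
    by (simp_all add: simple_path_join_loop_eq arc_reversepath)
  note J = Jordan_inside_outside[OF c]
  obtain z where z: "z \<in> inside (path_image c)" using J by blast
  define f where "f = (\<lambda>w. 1 / (w - z))"
  have inj: "u = v" if "f u = f v" for u v
    using that by (simp add: f_def)
  have "q3 \<notin> path_image c" "q3 \<notin> inside (path_image c)"
    using True q(3) int unfolding pc by blast+
  then have q3: "q3 \<in> outside (path_image c)" using inside_Un_outside[of "path_image c"] by blast
  \<comment> \<open>Otherwise \<open>W\<close>, and with it \<open>q3\<close>, would lie inside. It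
    follows that \<open>z\<close> is not in the closure of \<open>W\<close>, so \<open>f\<close> is
    continuous there and preserves the closure relations.\<close>
  have "W \<inter> inside (path_image c) = {}"
  proof (rule ccontr)
    assume "W \<inter> inside (path_image c) \<noteq> {}"
    then have "insert q3 W \<subseteq> inside (path_image c)"
      by (intro connected_subset_inside[OF connected_insert_closure[OF W(1) cl(3)]])
        (use W(2) q(3) int pc in auto)
    then show False using q3 outside_no_overlap inside_Int_outside[of "path_image c"] cl(3) by blast
  qed
  then have zW: "z \<notin> closure W" using z J open_Int_closure_eq_empty[of "inside (path_image c)" W] by blast
  have zg: "z \<notin> path_image g1" "z \<notin> path_image g2" "z \<notin> path_image g3"
    using z True inside_no_overlap[of "path_image c"] unfolding pc by blast+
  have cont: "continuous_on A f" if "z \<notin> A" for A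
    unfolding f_def using that by (intro continuous_intros) auto
  have arcf: "arc (f \<circ> g)" if "arc g" "z \<notin> path_image g" for g
    using that cont[OF that(2)] unfolding arc_def
    by (auto intro!: path_continuous_image simp: inj_on_def dest!: inj)
  have im: "path_image (f \<circ> g) = f ` path_image g" for g by (simp add: path_image_compose)
  have int_im: "f ` A \<inter> f ` B = f ` (A \<inter> B)" for A B by (auto dest!: inj)
  have clf: "f x \<in> closure (f ` W)" if "x \<in> closure W" for x
    using image_closure_subset[OF cont[OF zW], of "closure (f ` W)"] closure_subset[of "f ` W"] that
    by auto
  have "f q3 \<in> inside (f ` path_image c)"
    using inversion_outside_subset_inside[OF c z] q3 unfolding f_def by blast
  then have ne: "path_image (f \<circ> g3) \<inter> inside (path_image (f \<circ> g1) \<union> path_image (f \<circ> g2)) \<noteq> {}"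
    using q(3) unfolding im pc image_Un by blast
  show False
  proof (rule no_common_face_inside[OF arcf arcf arcf _ _ _ _ _ _ _ _ _ _ _ clf[OF cl(1)] clf[OF cl(2)] clf[OF cl(3)] _ _ _ ne])
    show "connected (f ` W)"
      using W(1) zW closure_subset[of W] by (intro connected_continuous_image cont) auto
    show "f ` W \<inter> (path_image (f \<circ> g1) \<union> path_image (f \<circ> g2) \<union> path_image (f \<circ> g3)) = {}"
      unfolding im image_Un[symmetric] int_im W(2) by simp
  qed (use arcs zg start finish int q in \<open>auto simp: im int_im pathstart_compose pathfinish_compose dest: inj\<close>)
qed

section \<open>The obstruction in the plane\<close>

text \<open>Joining \<open>a\<close> to \<open>b\<close> through each \<open>K j\<close> gives a
  theta curve. The links from \<open>p\<close> into each \<open>K j\<close> make the face of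
  \<open>p\<close> touch all three arcs, against \<open>no_common_face\<close>.\<close>

lemma no_K33_path_connected:
  fixes K :: "nat \<Rightarrow> complex set"
  assumes pK: "\<And>j. j < 3 \<Longrightarrow> path_connected (K j)"
    and ne: "\<And>j. j < 3 \<Longrightarrow> K j \<noteq> {}"
    and disj: "\<And>i j. i < 3 \<Longrightarrow> j < 3 \<Longrightarrow> i \<noteq> j \<Longrightarrow> K i \<inter> K j = {}"
    and notin: "\<And>j. j < 3 \<Longrightarrow> a \<notin> K j \<and> b \<notin> K j \<and> p \<notin> K j"
    and dist: "a \<noteq> b" "a \<noteq> p" "b \<noteq> p"
    and pa: "\<And>j. j < 3 \<Longrightarrow> path_connected (insert a (K j))"
    and pb: "\<And>j. j < 3 \<Longrightarrow> path_connected (insert b (K j))"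
    and pp: "\<And>j. j < 3 \<Longrightarrow> path_connected (insert p (K j))"
  shows False
proof -
  have "\<exists>g. arc g \<and> path_image g \<subseteq> insert a (insert b (K j)) \<and> pathstart g = a \<and> pathfinish g = b"
    if "j < 3" for j
  proof -
    have "path_connected (insert a (K j) \<union> insert b (K j))"
      using pa[OF that] pb[OF that] ne[OF that] by (intro path_connected_Un) auto
    then have "path_connected (insert a (insert b (K j)))"
      by (simp add: insert_commute)
    then show ?thesis using dist(1) unfolding path_connected_arcwise by blast
  qed
  then obtain g where g: "\<And>j. j < 3 \<Longrightarrow> arc (g j)"
      "\<And>j. j < 3 \<Longrightarrow> path_image (g j) \<subseteq> insert a (insert b (K j))"
      "\<And>j. j < 3 \<Longrightarrow> pathstart (g j) = a" "\<And>j. j < 3 \<Longrightarrow> pathfinish (g j) = b"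
    by metis
  have ends: "a \<in> path_image (g j)" "b \<in> path_image (g j)" if "j < 3" for j
    using g(3,4)[OF that] pathstart_in_path_image[of "g j"] pathfinish_in_path_image[of "g j"] by auto
  have int: "path_image (g i) \<inter> path_image (g j) = {a,b}" if "i < 3" "j < 3" "i \<noteq> j" for i j
    using g(2)[OF that(1)] g(2)[OF that(2)] disj[OF that] ends[OF that(1)] ends[OF that(2)] by blast
  define T where "T = path_image (g 0) \<union> path_image (g 1) \<union> path_image (g 2)"
  have "{..<3} = {0, 1, 2::nat}" by auto
  then have T: "T = (\<Union>j<3. path_image (g j))" unfolding T_def by auto
  have pT: "p \<notin> T" unfolding T using g(2) notin dist by blast
  have "closed T" unfolding T_def using g(1) by (intro closed_Un closed_arc_image) auto
  \<comment> \<open>The face of the theta curve \<open>T\<close> that contains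
    \<open>p\<close>.\<close>
  define W where "W = connected_component_set (- T) p"
  have W: "connected W" "W \<inter> T = {}" "p \<in> W"
    unfolding W_def using connected_component_subset[of "- T" p] pT by auto
  have oW: "open W" unfolding W_def using \<open>closed T\<close> by (intro open_connected_component) auto
  have clW: "closure W \<subseteq> W \<union> T"
    using Path_Connected.frontier_of_connected_component_subset[of "- T" p] frontier_subset_closed[OF \<open>closed T\<close>]
    unfolding W_def[symmetric] by (auto simp: closure_Un_frontier)
  have "\<exists>q. q \<in> closure W \<and> q \<in> path_image (g j) - {a,b}" if j: "j < 3" for j
  proof (rule ccontr)
    assume "\<nexists>q. q \<in> closure W \<and> q \<in> path_image (g j) - {a,b}"
    then have no: "closure W \<inter> (path_image (g j) - {a,b}) = {}" by blast
    let ?Z = "insert p (K j)"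
    \<comment> \<open>The other two arcs run in the other \<open>K i\<close>, apart from
      \<open>a\<close> and \<open>b\<close>, so \<open>?Z\<close> can meet \<open>T\<close> only in
      inner points of \<open>g j\<close>.\<close>
    have ZT: "?Z \<inter> T \<subseteq> path_image (g j) - {a,b}"
    proof
      fix x assume x: "x \<in> ?Z \<inter> T"
      then obtain i where i: "i < 3" "x \<in> path_image (g i)" unfolding T by blast
      have "x \<in> K j" using x pT by blast
      moreover have "i = j" using i g(2)[OF i(1)] disj[OF i(1) j] notin[OF j] \<open>x \<in> K j\<close> by blast
      ultimately show "x \<in> path_image (g j) - {a,b}" using i notin[OF j] by blast
    qed
    \<comment> \<open>If the face did not touch arc \<open>j\<close>, then
      \<open>?Z \<inter> W\<close> would be clopen in the connected set \<open>?Z\<close>. As it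
      contains \<open>p\<close>, all of \<open>?Z\<close> would lie in \<open>W\<close>. But the
      midpoint of \<open>g j\<close> lies in \<open>K j\<close> and on \<open>T\<close>.\<close>
    have eq: "?Z \<inter> W = ?Z \<inter> closure W" using clW no ZT closure_subset[of W] by blast
    have "openin (top_of_set ?Z) (?Z \<inter> W)" using oW by (rule openin_open_Int)
    moreover have "closedin (top_of_set ?Z) (?Z \<inter> W)" unfolding eq by (rule closedin_closed_Int) simp
    moreover have "connected ?Z" using pp[OF j] path_connected_imp_connected by blast
    ultimately have "?Z \<inter> W = ?Z" using W(3) unfolding connected_clopen by blast
    moreover have "g j (1/2) \<in> path_image (g j)" by (auto simp: path_image_def)
    moreover have "g j (1/2) \<noteq> a" "g j (1/2) \<noteq> b"
      using g(1,3,4)[OF j] inj_onD[of "g j" "{0..1}" "1/2" 0] inj_onD[of "g j" "{0..1}" "1/2" 1]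
      by (auto simp: arc_def pathstart_def pathfinish_def)
    ultimately show False using g(2)[OF j] W(2) j unfolding T by blast
  qed
  then obtain q where q: "\<And>j. j < 3 \<Longrightarrow> q j \<in> closure W \<and> q j \<in> path_image (g j) - {a,b}" by metis
  have l3: "0 < (3::nat)" "1 < (3::nat)" "2 < (3::nat)" by auto
  have ql: "q j \<in> closure W" "q j \<in> path_image (g j) - {a,b}" if "j < 3" for j
    using q[OF that] by auto
  show False
    by (rule no_common_face[OF g(1)[OF l3(1)] g(1)[OF l3(2)] g(1)[OF l3(3)]
        g(3)[OF l3(1)] g(3)[OF l3(2)] g(3)[OF l3(3)] g(4)[OF l3(1)] g(4)[OF l3(2)] g(4)[OF l3(3)]
        int[OF l3(1,2)] int[OF l3(1,3)] int[OF l3(2,3)] W(1) W(2)[unfolded T_def]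
        ql(1)[OF l3(1)] ql(1)[OF l3(2)] ql(1)[OF l3(3)]
        ql(2)[OF l3(1)] ql(2)[OF l3(2)] ql(2)[OF l3(3)]]) simp_all
qed

section \<open>Drawings and \<open>K\<^sub>3\<^sub>,\<^sub>3\<close> minors\<close>

definition restr_adj :: "'a sgraph \<Rightarrow> 'a set \<Rightarrow> ('a \<times> 'a) set" where
  "restr_adj G S = {(u, v). u \<in> S \<and> v \<in> S \<and> adj G u v}"

definition connected_on :: "'a sgraph \<Rightarrow> 'a set \<Rightarrow> bool" where
  "connected_on G Q \<longleftrightarrow> (\<forall>u\<in>Q. \<forall>v\<in>Q. (u, v) \<in> (restr_adj G Q)\<^sup>*)"

lemma adj_sym: "adj G u v \<longleftrightarrow> adj G v u"
  by (simp add: adj_def insert_commute)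

lemma sgraph_edgeE:
  assumes "sgraph G" "e \<in> snd G"
  obtains u v where "u \<noteq> v" "u \<in> fst G" "v \<in> fst G" "e = {u, v}"
proof -
  have "\<exists>u v. u \<noteq> v \<and> u \<in> fst G \<and> v \<in> fst G \<and> e = {u, v}"
    using assms by (simp add: sgraph_def)
  then show thesis using that by (elim exE conjE)
qed

lemma sgraph_adjD:
  assumes "sgraph G" "adj G u v"
  shows "u \<noteq> v" "u \<in> fst G" "v \<in> fst G"
proof -
  obtain a b where "a \<noteq> b" "a \<in> fst G" "b \<in> fst G" "{u, v} = {a, b}"
    using sgraph_edgeE[OF assms(1) assms(2)[unfolded adj_def]] .
  then show "u \<noteq> v" "u \<in> fst G" "v \<in> fst G" by (auto simp: doubleton_eq_iff)
qed

lemma restr_adj_rtrancl_sym: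
  assumes "(u, v) \<in> (restr_adj G S)\<^sup>*"
  shows "(v, u) \<in> (restr_adj G S)\<^sup>*"
proof -
  have "sym (restr_adj G S)" by (auto simp: sym_def restr_adj_def adj_sym)
  then show ?thesis using assms sym_rtrancl by (metis symD)
qed

lemma restr_adj_mono: "S \<subseteq> T \<Longrightarrow> restr_adj G S \<subseteq> restr_adj G T"
  by (auto simp: restr_adj_def)

lemma connected_onI:
  assumes "\<And>v. v \<in> Q \<Longrightarrow> (u, v) \<in> (restr_adj G Q)\<^sup>*"
  shows "connected_on G Q"
  unfolding connected_on_def using assms restr_adj_rtrancl_sym rtrancl_trans by metis

lemma connected_on_Un:
  assumes "connected_on G P" "connected_on G Q" "u \<in> P" "u \<in> Q"
  shows "connected_on G (P \<union> Q)"
proof (rule connected_onI[of _ u])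
  fix v assume "v \<in> P \<union> Q"
  then have "(u, v) \<in> (restr_adj G P)\<^sup>* \<union> (restr_adj G Q)\<^sup>*"
    using assms unfolding connected_on_def by blast
  then show "(u, v) \<in> (restr_adj G (P \<union> Q))\<^sup>*"
    using rtrancl_mono[OF restr_adj_mono[of P "P \<union> Q" G]] rtrancl_mono[OF restr_adj_mono[of Q "P \<union> Q" G]]
    by blast
qed

text \<open>This serves the half-open edges that lead to the shared vertices.\<close>

lemma path_connected_arc_minus_end:
  assumes "arc g"
  shows "path_connected (path_image g - {pathfinish g})"
proof -
  have "path_image g - {pathfinish g} = g ` {0..<1}"
    using assms inj_onD[of g "{0..1}" _ 1] unfolding arc_def path_image_def pathfinish_def
    by (force simp: image_iff)
  moreover have "continuous_on {0..<1} g"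
    by (rule continuous_on_subset[of "{0..1}"]) (use assms in \<open>auto simp: arc_def path_def\<close>)
  ultimately show ?thesis
    by (simp add: path_connected_continuous_image convex_imp_path_connected)
qed

section \<open>Regions of a plane drawing\<close>

text \<open>The body of \<open>planar\<close> with its witnesses made explicit, so that they can be
  fixed.\<close>

definition drawing :: "'a sgraph \<Rightarrow> ('a \<Rightarrow> real \<times> real) \<Rightarrow> ('a set \<Rightarrow> real \<Rightarrow> real \<times> real) \<Rightarrow> bool" where
  "drawing G pos \<gamma> \<longleftrightarrow> inj_on pos (fst G) \<and>
      (\<forall>e\<in>snd G. arc (\<gamma> e) \<and> {pathstart (\<gamma> e), pathfinish (\<gamma> e)} = pos ` e \<and>
                  path_image (\<gamma> e) \<inter> pos ` fst G = pos ` e) \<and>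
      (\<forall>e\<in>snd G. \<forall>e'\<in>snd G. e \<noteq> e' \<longrightarrow>
                  path_image (\<gamma> e) \<inter> path_image (\<gamma> e') \<subseteq> pos ` (e \<inter> e'))"

text \<open>The part of the drawing spanned by \<open>Q\<close>, with the edges from \<open>Q\<close> to \<open>X\<close> half-open: for disjoint
  \<open>Q\<close> these sets are disjoint, although the vertices in \<open>X\<close> are shared.\<close>

definition region :: "'a sgraph \<Rightarrow> ('a \<Rightarrow> real \<times> real) \<Rightarrow> ('a set \<Rightarrow> real \<Rightarrow> real \<times> real) \<Rightarrow>
    'a set \<Rightarrow> 'a set \<Rightarrow> (real \<times> real) set" where
  "region G pos \<gamma> X Q =
     (pos ` Q \<union> (\<Union>e\<in>{e \<in> snd G. e \<subseteq> Q \<union> X \<and> e \<inter> Q \<noteq> {}}. path_image (\<gamma> e))) - pos ` X"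

text \<open>Each point runs along its edge to a vertex of \<open>Q\<close>, and \<open>Q\<close> is
  connected in the graph. The set \<open>Y\<close> selects the shared vertices to be put back: none,
  or a single one, in the application.\<close>

lemma path_connected_region:
  assumes G: "sgraph G" and D: "drawing G pos \<gamma>"
    and sub: "Q \<subseteq> fst G" "X \<subseteq> fst G" "Q \<inter> X = {}" "Y \<subseteq> X" "Q \<noteq> {}"
    and conn: "connected_on G Q" and nb: "\<And>y. y \<in> Y \<Longrightarrow> \<exists>w\<in>Q. adj G y w"
  shows "path_connected (region G pos \<gamma> X Q \<union> pos ` Y)"
proof -
  let ?R = "region G pos \<gamma> X Q \<union> pos ` Y"
  have inj: "inj_on pos (fst G)"
    and arc: "\<And>e. e \<in> snd G \<Longrightarrow> arc (\<gamma> e)"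
    and ends: "\<And>e. e \<in> snd G \<Longrightarrow> {pathstart (\<gamma> e), pathfinish (\<gamma> e)} = pos ` e"
    and vert: "\<And>e. e \<in> snd G \<Longrightarrow> path_image (\<gamma> e) \<inter> pos ` fst G = pos ` e"
    using D unfolding drawing_def by blast+
  have vX: "path_image (\<gamma> e) \<inter> pos ` X = pos ` (e \<inter> X)" if "e \<in> snd G" for e
  proof -
    have "e \<subseteq> fst G" using sgraph_edgeE[OF G that] by (metis empty_subsetI insert_subset)
    have "path_image (\<gamma> e) \<inter> pos ` X = pos ` e \<inter> pos ` X" using vert[OF that] sub(2) by blast
    then show ?thesis using inj_on_image_Int[OF inj \<open>e \<subseteq> fst G\<close> sub(2)] by simp
  qed
  have QR: "pos ` Q \<subseteq> ?R"
    using sub inj unfolding region_def inj_on_def by blast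
  have edge: "path_component ?R z (pos q)"
    if e: "e \<in> snd G" "e \<subseteq> Q \<union> X" "q \<in> e" "q \<in> Q" and z: "z \<in> path_image (\<gamma> e)" "z \<notin> pos ` X" for e q z
  proof -
    obtain a b where "a \<noteq> b" "a \<in> fst G" "b \<in> fst G" "e = {a, b}"
      using sgraph_edgeE[OF G e(1)] .
    moreover have "q = a \<or> q = b" using e(3) calculation by blast
    ultimately obtain u where u: "u \<noteq> q" "e = {q, u}" "u \<in> fst G"
      by (metis insert_commute)
    have R: "path_image (\<gamma> e) - pos ` X \<subseteq> ?R" using e unfolding region_def by blast
    have qX: "pos q \<notin> pos ` X" using sub e(4) inj unfolding inj_on_def by blast
    have qim: "pos q \<in> path_image (\<gamma> e)" using vert[OF e(1)] u(2) by blast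
    \<comment> \<open>As one end is in \<open>Q\<close>, removing \<open>X\<close> takes away
      nothing or exactly one end of the arc.\<close>
    have "path_connected (path_image (\<gamma> e) - pos ` X)"
    proof (cases "u \<in> X")
      case False
      then have "e \<inter> X = {}" using u(2) e(4) sub(3) by blast
      then have "path_image (\<gamma> e) - pos ` X = path_image (\<gamma> e)" using vX[OF e(1)] by blast
      then show ?thesis using arc[OF e(1)] arc_imp_path path_connected_path_image by metis
    next
      case True
      then have "e \<inter> X = {u}" using u(2) e(4) sub(3) by blast
      then have "path_image (\<gamma> e) \<inter> pos ` X = {pos u}" using vX[OF e(1)] by simp
      then have *: "path_image (\<gamma> e) - pos ` X = path_image (\<gamma> e) - {pos u}" by blast
      have "pos u = pathstart (\<gamma> e) \<or> pos u = pathfinish (\<gamma> e)"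
        using ends[OF e(1)] u(2) by blast
      then show ?thesis
        unfolding * using path_connected_arc_minus_end[OF arc[OF e(1)]]
          path_connected_arc_minus_end[OF arc_reversepath[OF arc[OF e(1)]]] by auto
    qed
    then have "path_component (path_image (\<gamma> e) - pos ` X) z (pos q)"
      using z qim qX by (simp add: path_connected_component)
    then show ?thesis using R path_component_of_subset by blast
  qed
  have adjQ: "path_component ?R (pos u) (pos v)" if "(u, v) \<in> restr_adj G Q" for u v
  proof (rule edge[of "{u, v}" v])
    show "pos u \<in> path_image (\<gamma> {u, v})"
      using that vert[of "{u, v}"] unfolding restr_adj_def adj_def by blast
    show "pos u \<notin> pos ` X" using that sub inj unfolding restr_adj_def inj_on_def by blast
  qed (use that in \<open>auto simp: restr_adj_def adj_def\<close>)
  obtain q0 where q0: "q0 \<in> Q" using sub by blast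
  have Qcomp: "path_component ?R (pos q) (pos q0)" if "q \<in> Q" for q
  proof -
    have "(q, q0) \<in> (restr_adj G Q)\<^sup>*" using conn that q0 unfolding connected_on_def by blast
    then show ?thesis
    proof (induction rule: converse_rtrancl_induct)
      case base
      show ?case using q0 QR by (auto intro!: path_component_refl)
    next
      case (step y z)
      then show ?case using adjQ path_component_trans by metis
    qed
  qed
  have "path_component ?R z (pos q0)" if z: "z \<in> ?R" for z
  proof (cases "z \<in> pos ` Y")
    case True
    then obtain y where y: "y \<in> Y" "z = pos y" by blast
    obtain w where w: "w \<in> Q" "adj G y w" using nb[OF y(1)] by blast
    let ?e = "{y, w}"
    have e: "?e \<in> snd G" using w(2) by (simp add: adj_def)
    have "?e \<inter> X = {y}" using w(1) y(1) sub(3,4) by blast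
    then have "path_image (\<gamma> ?e) \<inter> pos ` X \<subseteq> {pos y}" using vX[OF e] by simp
    then have "path_image (\<gamma> ?e) \<subseteq> ?R" using e w(1) y(1) sub unfolding region_def by blast
    moreover have "path_component (path_image (\<gamma> ?e)) (pos y) (pos w)"
      using path_connected_path_image[OF arc_imp_path[OF arc[OF e]]] vert[OF e]
      unfolding path_connected_component by blast
    ultimately have "path_component ?R z (pos w)"
      using path_component_of_subset y(2) by blast
    then show ?thesis using Qcomp[OF w(1)] path_component_trans by metis
  next
    case False
    then have zR: "z \<in> region G pos \<gamma> X Q" using z by blast
    show ?thesis
    proof (cases "z \<in> pos ` Q")
      case True then show ?thesis using Qcomp by blast
    next
      case False
      then obtain e q where e: "e \<in> snd G" "e \<subseteq> Q \<union> X" "q \<in> e" "q \<in> Q" "z \<in> path_image (\<gamma> e)" "z \<notin> pos ` X"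
        using zR unfolding region_def by blast
      from edge[OF this] show ?thesis using Qcomp[OF e(4)] path_component_trans by metis
    qed
  qed
  then show ?thesis
    unfolding path_connected_component by (meson path_component_sym path_component_trans)
qed

text \<open>Distinct edges meet only in common ends. An edge in \<open>Q \<union> X\<close> and one
  in \<open>Q' \<union> X\<close> can share only vertices of \<open>X\<close>, which the regions
  leave out.\<close>

lemma region_disjoint:
  assumes D: "drawing G pos \<gamma>"
    and sub: "Q \<subseteq> fst G" "Q' \<subseteq> fst G" "X \<subseteq> fst G" "Q \<inter> Q' = {}" "Q \<inter> X = {}" "Q' \<inter> X = {}"
  shows "region G pos \<gamma> X Q \<inter> region G pos \<gamma> X Q' = {}"
proof -
  have inj: "inj_on pos (fst G)"
    and vert: "\<And>e. e \<in> snd G \<Longrightarrow> path_image (\<gamma> e) \<inter> pos ` fst G = pos ` e"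
    and cross: "\<And>e e'. e \<in> snd G \<Longrightarrow> e' \<in> snd G \<Longrightarrow> e \<noteq> e' \<Longrightarrow>
        path_image (\<gamma> e) \<inter> path_image (\<gamma> e') \<subseteq> pos ` (e \<inter> e')"
    using D unfolding drawing_def by blast+
  have vin: False if "e \<in> snd G" "e \<subseteq> P \<union> X" "q \<in> P'" "pos q \<in> path_image (\<gamma> e)"
    "P \<subseteq> fst G" "P' \<subseteq> fst G" "P \<inter> P' = {}" "P' \<inter> X = {}" for e q P P'
  proof -
    have "pos q \<in> pos ` e" using vert[OF that(1)] that(3,4,6) by blast
    then have "q \<in> e" using inj that(2,3,5,6) sub(3) unfolding inj_on_def by blast
    then show False using that by blast
  qed
  show ?thesis
  proof (rule equals0I)
    fix z assume "z \<in> region G pos \<gamma> X Q \<inter> region G pos \<gamma> X Q'"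
    then have z: "z \<notin> pos ` X"
      "z \<in> pos ` Q \<or> (\<exists>e\<in>snd G. e \<subseteq> Q \<union> X \<and> e \<inter> Q \<noteq> {} \<and> z \<in> path_image (\<gamma> e))"
      "z \<in> pos ` Q' \<or> (\<exists>e\<in>snd G. e \<subseteq> Q' \<union> X \<and> e \<inter> Q' \<noteq> {} \<and> z \<in> path_image (\<gamma> e))"
      unfolding region_def by auto
    from z(2) show False
    proof
      assume zQ: "z \<in> pos ` Q"
      from z(3) show False
      proof
        assume "z \<in> pos ` Q'"
        then show False using zQ inj sub unfolding inj_on_def by blast
      qed (use zQ vin[of _ Q' _ Q] sub in blast)
    next
      assume "\<exists>e\<in>snd G. e \<subseteq> Q \<union> X \<and> e \<inter> Q \<noteq> {} \<and> z \<in> path_image (\<gamma> e)"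
      then obtain e where e: "e \<in> snd G" "e \<subseteq> Q \<union> X" "z \<in> path_image (\<gamma> e)" by blast
      from z(3) show False
      proof
        assume "z \<in> pos ` Q'"
        then show False using e vin[of e Q _ Q'] sub by blast
      next
        assume "\<exists>e\<in>snd G. e \<subseteq> Q' \<union> X \<and> e \<inter> Q' \<noteq> {} \<and> z \<in> path_image (\<gamma> e)"
        then obtain e' where e': "e' \<in> snd G" "e' \<subseteq> Q' \<union> X" "e' \<inter> Q' \<noteq> {}" "z \<in> path_image (\<gamma> e')"
          by blast
        have "e \<noteq> e'" using e(2) e'(3) sub by blast
        then have "z \<in> pos ` (e \<inter> e')" using cross[OF e(1) e'(1)] e(3) e'(4) by blast
        moreover have "e \<inter> e' \<subseteq> X" using e(2) e'(2) sub by blast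
        ultimately show False using z(1) by blast
      qed
    qed
  qed
qed

text \<open>One side of the minor consists of the branch sets \<open>Q j\<close>, the other of
  single vertices. The regions of the \<open>Q j\<close> are the sets needed for the topological
  obstruction.\<close>

lemma planar_no_K33_minor:
  fixes Q :: "nat \<Rightarrow> 'a set"
  assumes G: "sgraph G" "planar G"
    and Q: "\<And>j. j < 3 \<Longrightarrow> Q j \<subseteq> fst G" "\<And>j. j < 3 \<Longrightarrow> connected_on G (Q j)"
    and disj: "\<And>i j. i < 3 \<Longrightarrow> j < 3 \<Longrightarrow> i \<noteq> j \<Longrightarrow> Q i \<inter> Q j = {}"
    and x: "x1 \<in> fst G" "x2 \<in> fst G" "x3 \<in> fst G" "x1 \<noteq> x2" "x1 \<noteq> x3" "x2 \<noteq> x3"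
    and notin: "\<And>j. j < 3 \<Longrightarrow> Q j \<inter> {x1, x2, x3} = {}"
    and nb: "\<And>j y. j < 3 \<Longrightarrow> y \<in> {x1, x2, x3} \<Longrightarrow> \<exists>w\<in>Q j. adj G y w"
  shows False
proof -
  obtain pos \<gamma> where D: "drawing G pos \<gamma>" using G(2) unfolding planar_def drawing_def by blast
  \<comment> \<open>Carries the drawing over to the complex plane, where
    \<open>no_K33_path_connected\<close> is stated.\<close>
  define h :: "real \<times> real \<Rightarrow> complex" where "h = (\<lambda>p. of_real (fst p) + \<i> * of_real (snd p))"
  have "h p = Complex (fst p) (snd p)" for p by (simp add: h_def Complex_eq)
  then have injh: "inj h" by (auto simp: inj_def prod_eq_iff)
  have conth: "continuous_on A h" for A unfolding h_def by (intro continuous_intros)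
  define K where "K = (\<lambda>j. region G pos \<gamma> {x1, x2, x3} (Q j))"
  have ne: "Q j \<noteq> {}" if "j < 3" for j using nb[OF that] by blast
  have inj: "inj_on pos (fst G)" using D unfolding drawing_def by blast
  have pc: "path_connected (K j \<union> pos ` Y)" if "j < 3" "Y \<subseteq> {x1, x2, x3}" for j Y
    unfolding K_def
    by (rule path_connected_region[OF G(1) D Q(1)[OF that(1)] _ notin[OF that(1)] that(2) ne[OF that(1)] Q(2)[OF that(1)]])
      (use x nb that in auto)
  have pch: "path_connected (h ` (K j \<union> pos ` Y))" if "j < 3" "Y \<subseteq> {x1, x2, x3}" for j Y
    using pc[OF that] conth path_connected_continuous_image by blast
  have hX: "h (pos y) \<notin> h ` K j" if "y \<in> {x1, x2, x3}" for y j
  proof -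
    have "pos y \<notin> K j" using that unfolding K_def region_def by blast
    then show ?thesis by (simp add: inj_image_mem_iff[OF injh])
  qed
  show False
  proof (rule no_K33_path_connected[of "\<lambda>j. h ` K j" "h (pos x1)" "h (pos x2)" "h (pos x3)"])
    fix j :: nat assume j: "j < 3"
    show "path_connected (h ` K j)" using pch[OF j, of "{}"] by simp
    show "path_connected (insert (h (pos x1)) (h ` K j))" using pch[OF j, of "{x1}"] by simp
    show "path_connected (insert (h (pos x2)) (h ` K j))" using pch[OF j, of "{x2}"] by simp
    show "path_connected (insert (h (pos x3)) (h ` K j))" using pch[OF j, of "{x3}"] by simp
    have "pos ` Q j \<inter> pos ` {x1, x2, x3} = {}"
      using inj Q(1)[OF j] notin[OF j] x unfolding inj_on_def by blast
    then show "h ` K j \<noteq> {}" using ne[OF j] unfolding K_def region_def by blast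
    show "h (pos x1) \<notin> h ` K j \<and> h (pos x2) \<notin> h ` K j \<and> h (pos x3) \<notin> h ` K j"
      using hX by auto
    fix i :: nat assume i: "i < 3" "i \<noteq> j"
    have "K i \<inter> K j = {}" unfolding K_def
      using region_disjoint[OF D Q(1)[OF i(1)] Q(1)[OF j] _ disj[OF i(1) j i(2)] notin[OF i(1)] notin[OF j]] x
      by auto
    then show "h ` K i \<inter> h ` K j = {}" by (simp add: image_Int[OF injh, symmetric])
  qed (use x inj in \<open>auto simp: inj_eq[OF injh] inj_on_def\<close>)
qed

section \<open>Components of vertex-critical graphs\<close>

text \<open>Up to renaming, a colouring of two vertices is known once it is known whether the
  colours agree. One transposition moves \<open>p\<close> to \<open>p'\<close>; a second corrects
  the image of \<open>q\<close> and leaves \<open>p'\<close> fixed.\<close>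

lemma recolor_two:
  fixes p q p' q' m :: nat
  assumes "p \<in> {1..m}" "q \<in> {1..m}" "p' \<in> {1..m}" "q' \<in> {1..m}" "(p = q) = (p' = q')"
  obtains \<pi> where "inj \<pi>" "\<And>i. i \<in> {1..m} \<Longrightarrow> \<pi> i \<in> {1..m}" "\<pi> p = p'" "\<pi> q = q'"
proof -
  define f where "f = Transposition.transpose p p'"
  define g where "g = Transposition.transpose (f q) q'"
  have fp: "f p = p'" and inj: "inj f" "inj g" by (simp_all add: f_def g_def)
  have rng: "f i \<in> {1..m}" if "i \<in> {1..m}" for i
    using that assms unfolding f_def Transposition.transpose_def by auto
  have "g i \<in> {1..m}" if "i \<in> {1..m}" for i
    using that rng[OF assms(2)] assms(4) unfolding g_def Transposition.transpose_def by auto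
  moreover have "g p' = p'"
  proof (cases "p = q")
    case True
    then show ?thesis using assms(5) fp by (simp add: g_def)
  next
    case False
    then have "f q \<noteq> p'" using fp inj(1) by (metis injD)
    then show ?thesis using False assms(5) by (simp add: g_def)
  qed
  moreover have "g (f q) = q'" by (simp add: g_def)
  ultimately show thesis
    using that[of "g \<circ> f"] inj fp rng by (simp add: inj_compose)
qed

definition comps :: "'a sgraph \<Rightarrow> 'a set \<Rightarrow> 'a set set" where
  "comps G S = (\<lambda>v. (restr_adj G S)\<^sup>* `` {v}) ` S"

lemma restr_adj_rtrancl_in:
  assumes "(u, v) \<in> (restr_adj G S)\<^sup>*" "u \<in> S"
  shows "v \<in> S"
  using assms by (induction rule: rtrancl_induct) (auto simp: restr_adj_def)

lemma comps_subset: "C \<in> comps G S \<Longrightarrow> C \<subseteq> S"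
  by (auto simp: comps_def intro: restr_adj_rtrancl_in)

lemma comps_nonempty: "C \<in> comps G S \<Longrightarrow> C \<noteq> {}"
  by (auto simp: comps_def)

lemma comps_disjoint:
  assumes "C \<in> comps G S" "D \<in> comps G S" "C \<noteq> D"
  shows "C \<inter> D = {}"
proof (rule ccontr)
  assume "C \<inter> D \<noteq> {}"
  then obtain w where w: "w \<in> C" "w \<in> D" by blast
  have *: "E = (restr_adj G S)\<^sup>* `` {w}" if E: "E \<in> comps G S" "w \<in> E" for E
  proof -
    obtain v where v: "E = (restr_adj G S)\<^sup>* `` {v}" using E(1) unfolding comps_def by blast
    then have vw: "(v, w) \<in> (restr_adj G S)\<^sup>*" using E(2) by simp
    show ?thesis
      unfolding v using rtrancl_trans[OF vw] rtrancl_trans[OF restr_adj_rtrancl_sym[OF vw]] by blast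
  qed
  show False using *[OF assms(1) w(1)] *[OF assms(2) w(2)] assms(3) by simp
qed

lemma comps_closed:
  assumes "C \<in> comps G S" "u \<in> C" "v \<in> S" "adj G u v"
  shows "v \<in> C"
proof -
  have "(u, v) \<in> restr_adj G S"
    using assms comps_subset unfolding restr_adj_def by blast
  then show ?thesis using assms(1,2) unfolding comps_def by (auto intro: rtrancl_into_rtrancl)
qed

text \<open>Two components of \<open>G - {a, b}\<close> that admit the same colour patterns on \<open>(a, b)\<close>
  (equal, different) cannot coexist: a colouring of \<open>G\<close> without the second one extends to it,
  after renaming colours, exactly because it extends to the first. This bound does not depend
  on the number of colours.\<close>

lemma card_comps_vertex_critical:
  assumes crit: "vertex_critical G k" and ab: "a \<in> fst G" "b \<in> fst G"
  shows "card (comps G (fst G - {a, b})) \<le> 4"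
proof -
  let ?S = "fst G - {a, b}"
  define proper where "proper = (\<lambda>T (c :: 'a \<Rightarrow> nat). (\<forall>v\<in>T. c v \<in> {1..k-1}) \<and>
      (\<forall>u\<in>T. \<forall>v\<in>T. adj G u v \<longrightarrow> c u \<noteq> c v))"
  \<comment> \<open>Patterns are sets of truth values, so there are only four of them.\<close>
  define pattern where "pattern = (\<lambda>C. {s. \<exists>c. proper (C \<union> {a, b}) c \<and> (c a = c b) = s})"
  have "inj_on pattern (comps G ?S)"
  proof (rule inj_onI, rule ccontr)
    fix C D assume C: "C \<in> comps G ?S" and D: "D \<in> comps G ?S"
      and eq: "pattern C = pattern D" and "C \<noteq> D"
    have dis: "C \<inter> D = {}" using comps_disjoint[OF C D \<open>C \<noteq> D\<close>] .
    have CS: "C \<subseteq> ?S" "D \<subseteq> ?S" using C D comps_subset by blast+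
    have "fst G - D \<subset> fst G" using comps_nonempty[OF D] CS by blast
    then have "colorable (induced G (fst G - D)) (k - 1)"
      using crit unfolding vertex_critical_def by blast
    then obtain c where c: "proper (fst G - D) c"
      unfolding colorable_def proper_def induced_def adj_def by auto
    have abD: "a \<in> fst G - D" "b \<in> fst G - D" using ab CS by auto
    have "C \<union> {a, b} \<subseteq> fst G - D" using CS dis abD by blast
    then have "proper (C \<union> {a, b}) c" using c unfolding proper_def by blast
    then have "(c a = c b) \<in> pattern C" unfolding pattern_def by blast
    then have "(c a = c b) \<in> pattern D" using eq by simp
    then obtain c' where c': "proper (D \<union> {a, b}) c'" "(c' a = c' b) = (c a = c b)"
      unfolding pattern_def by blast
    have rng: "c' a \<in> {1..k-1}" "c' b \<in> {1..k-1}" "c a \<in> {1..k-1}" "c b \<in> {1..k-1}"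
      using c' c abD unfolding proper_def by blast+
    obtain \<pi> where \<pi>: "inj \<pi>" "\<And>i. i \<in> {1..k-1} \<Longrightarrow> \<pi> i \<in> {1..k-1}" "\<pi> (c' a) = c a" "\<pi> (c' b) = c b"
      using recolor_two[OF rng c'(2)] by blast
    \<comment> \<open>The two colourings agree on \<open>a\<close> and \<open>b\<close> after
      renaming. An edge that meets \<open>D\<close> has both ends in
      \<open>D \<union> {a, b}\<close>, where the renamed \<open>c'\<close> is proper; every other
      edge is handled by \<open>c\<close>.\<close>
    define c'' where "c'' = (\<lambda>v. if v \<in> D then \<pi> (c' v) else c v)"
    have ab'': "c'' v = \<pi> (c' v)" if "v \<in> D \<union> {a, b}" for v
      using that abD \<pi>(3,4) unfolding c''_def by auto
    have "proper (fst G) c''"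
      unfolding proper_def
    proof (intro conjI ballI impI)
      fix v assume "v \<in> fst G"
      then show "c'' v \<in> {1..k-1}"
        using c c' \<pi>(2) unfolding c''_def proper_def by (cases "v \<in> D") auto
    next
      fix u v assume uv: "u \<in> fst G" "v \<in> fst G" "adj G u v"
      have in1: "y \<in> D \<union> {a, b}" if "x \<in> D" "adj G x y" "y \<in> fst G" for x y
        using comps_closed[OF D that(1) _ that(2)] that(3) by blast
      show "c'' u \<noteq> c'' v"
      proof (cases "u \<in> D \<or> v \<in> D")
        case True
        then have "u \<in> D \<union> {a, b}" "v \<in> D \<union> {a, b}"
          using in1[of u v] in1[of v u] uv adj_sym[of G u v] by blast+
        then show ?thesis
          using ab'' c'(1) uv(3) \<pi>(1) unfolding proper_def by (metis injD)
      next
        case False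
        then show ?thesis using c uv unfolding c''_def proper_def by auto
      qed
    qed
    then have "colorable G (k - 1)" unfolding colorable_def proper_def by blast
    then show False using crit unfolding vertex_critical_def chromatic_def by blast
  qed
  then have "card (comps G ?S) = card (pattern ` comps G ?S)" by (simp add: card_image)
  also have "\<dots> \<le> card (Pow (UNIV :: bool set))" by (intro card_mono) auto
  also have "\<dots> = 4" by (simp add: card_Pow)
  finally show ?thesis .
qed

text \<open>Pigeonhole: at most four components, and the summand 2 pays for \<open>a\<close> and
  \<open>b\<close> themselves.\<close>

lemma large_component:
  assumes G: "sgraph G" and crit: "vertex_critical G k" and ab: "a \<in> fst G" "b \<in> fst G"
    and U: "U \<subseteq> fst G" "card U > 4 * M + 2"
  obtains C where "C \<in> comps G (fst G - {a, b})" "card (U \<inter> C) > M"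
proof (rule ccontr)
  assume "\<not> thesis"
  then have le: "card (U \<inter> C) \<le> M" if "C \<in> comps G (fst G - {a, b})" for C
    using that \<open>\<And>C. C \<in> comps G (fst G - {a, b}) \<Longrightarrow> M < card (U \<inter> C) \<Longrightarrow> thesis\<close> by force
  let ?K = "comps G (fst G - {a, b})"
  have fin: "finite (fst G)" using G by (simp add: sgraph_def)
  then have finK: "finite ?K" by (simp add: comps_def)
  have finU: "finite U" using fin U finite_subset by blast
  have "U \<subseteq> {a, b} \<union> (\<Union>C\<in>?K. U \<inter> C)"
    using U(1) unfolding comps_def by auto
  then have "card U \<le> card ({a, b} \<union> (\<Union>C\<in>?K. U \<inter> C))"
    using finU finK by (intro card_mono) auto
  also have "\<dots> \<le> card {a, b} + card (\<Union>C\<in>?K. U \<inter> C)" by (rule card_Un_le)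
  also have "card {a, b} \<le> 2" by (simp add: card_insert_if)
  also have "card (\<Union>C\<in>?K. U \<inter> C) \<le> (\<Sum>C\<in>?K. card (U \<inter> C))" using finK by (rule card_UN_le)
  also have "\<dots> \<le> of_nat (card ?K) * M" using le by (intro sum_bounded_above) auto
  also have "\<dots> \<le> 4 * M" using card_comps_vertex_critical[OF crit ab] by simp
  finally show False using U(2) by simp
qed

section \<open>Fans in breadth-first search trees\<close>

text \<open>Depths and parents of a breadth-first search tree; \<open>par\<close> carries
  information only at positive depth. The axiom \<open>adj_depth\<close> is what makes tree paths
  towards the root induced.\<close>

locale bfs_tree =
  fixes G :: "'a sgraph" and C :: "'a set" and r :: 'a and d :: "'a \<Rightarrow> nat" and par :: "'a \<Rightarrow> 'a"
  assumes sgraph: "sgraph G" and C_subset: "C \<subseteq> fst G"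
    and depth_zero: "\<And>v. v \<in> C \<Longrightarrow> d v = 0 \<Longrightarrow> v = r"
    and par_in: "\<And>v. v \<in> C \<Longrightarrow> d v > 0 \<Longrightarrow> par v \<in> C"
    and par_adj: "\<And>v. v \<in> C \<Longrightarrow> d v > 0 \<Longrightarrow> adj G (par v) v"
    and par_depth: "\<And>v. v \<in> C \<Longrightarrow> d v > 0 \<Longrightarrow> d v = Suc (d (par v))"
    and adj_depth: "\<And>u v. u \<in> C \<Longrightarrow> v \<in> C \<Longrightarrow> adj G u v \<Longrightarrow> d v \<le> Suc (d u)"
begin

lemma ancestor:
  assumes "v \<in> C" "i \<le> d v"
  shows "(par ^^ i) v \<in> C \<and> d ((par ^^ i) v) = d v - i"
  using assms(2)
proof (induction i)
  case 0
  then show ?case using assms by simp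
next
  case (Suc i)
  then have IH: "(par ^^ i) v \<in> C" "d ((par ^^ i) v) = d v - i" by auto
  then have "d ((par ^^ i) v) > 0" using Suc.prems by simp
  then show ?case using par_in[OF IH(1)] par_depth[OF IH(1)] IH(2) by simp
qed

lemma ancestor_adj:
  assumes "v \<in> C" "i < d v"
  shows "adj G ((par ^^ Suc i) v) ((par ^^ i) v)"
  using par_adj[of "(par ^^ i) v"] ancestor[of v i] assms by simp

text \<open>The ancestors of \<open>v\<close> at depths below \<open>t\<close> would form an induced
  path, as adjacent vertices differ by at most one in depth.\<close>

lemma depth_less:
  assumes "Pt_free t G" "v \<in> C"
  shows "d v < t"
proof (rule ccontr)
  assume "\<not> d v < t"
  then have t: "t \<le> d v" by simp
  define p where "p = (\<lambda>i. (par ^^ (d v - i)) v)"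
  have p: "p i \<in> C" "d (p i) = i" if "i < t" for i
    using ancestor[OF assms(2), of "d v - i"] that t unfolding p_def by auto
  have step: "adj G (p i) (p (Suc i))" if "Suc i < t" for i
  proof -
    have "d v - i = Suc (d v - Suc i)" "d v - Suc i < d v" using that t by auto
    then show ?thesis using ancestor_adj[OF assms(2), of "d v - Suc i"] unfolding p_def by simp
  qed
  have "adj G (p i) (p j) \<longleftrightarrow> (i = j + 1 \<or> j = i + 1)" if "i < t" "j < t" for i j
  proof
    assume a: "adj G (p i) (p j)"
    have "j \<le> Suc i" "i \<le> Suc j"
      using adj_depth[OF p(1)[OF that(1)] p(1)[OF that(2)] a]
        adj_depth[OF p(1)[OF that(2)] p(1)[OF that(1)]] a adj_sym p(2) that by metis+
    moreover have "i \<noteq> j" using sgraph_adjD(1)[OF sgraph a] by blast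
    ultimately show "i = j + 1 \<or> j = i + 1" by linarith
  next
    assume "i = j + 1 \<or> j = i + 1"
    then show "adj G (p i) (p j)" using step[of i] step[of j] that adj_sym[of G "p i" "p j"] by auto
  qed
  moreover have "inj_on p {..<t}" using p(2) by (metis inj_onI lessThan_iff)
  moreover have "p ` {..<t} \<subseteq> fst G" using p(1) C_subset by auto
  ultimately have "has_induced_path t G" unfolding has_induced_path_def by blast
  then show False using assms(1) by (simp add: Pt_free_def)
qed

end

text \<open>The depth is the distance from a vertex generating the component, and the parent is the
  last but one vertex of a shortest walk.\<close>

lemma exists_bfs_tree:
  assumes G: "sgraph G" and S: "S \<subseteq> fst G" and C: "C \<in> comps G S"
  obtains r d par where "bfs_tree G C r d par"
proof -
  obtain r where r: "r \<in> S" "C = (restr_adj G S)\<^sup>* `` {r}" using C unfolding comps_def by blast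
  define d where "d = (\<lambda>v. LEAST n. (r, v) \<in> restr_adj G S ^^ n)"
  have ex: "(r, v) \<in> restr_adj G S ^^ d v" if "v \<in> C" for v
    using that r(2) unfolding d_def by (auto simp: rtrancl_power intro: LeastI)
  have le: "d v \<le> n" if "(r, v) \<in> restr_adj G S ^^ n" for v n
    using that unfolding d_def by (rule Least_le)
  have inC: "v \<in> C" if "(r, v) \<in> restr_adj G S ^^ n" for v n
    using that r(2) relpow_imp_rtrancl by fastforce
  have "\<exists>w. w \<in> C \<and> adj G w v \<and> d v = Suc (d w)" if v: "v \<in> C" "d v > 0" for v
  proof -
    obtain m where m: "d v = Suc m" using v(2) gr0_implies_Suc by blast
    then have "(r, v) \<in> restr_adj G S ^^ Suc m" using ex[OF v(1)] by simp
    then obtain w where w: "(r, w) \<in> restr_adj G S ^^ m" "(w, v) \<in> restr_adj G S" by auto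
    have "d w \<le> m" using le[OF w(1)] .
    moreover have "(r, v) \<in> restr_adj G S ^^ Suc (d w)" using ex[OF inC[OF w(1)]] w(2) by auto
    then have "d v \<le> Suc (d w)" by (rule le)
    ultimately have "d v = Suc (d w)" using m by simp
    then show ?thesis using inC[OF w(1)] w(2) unfolding restr_adj_def by blast
  qed
  then obtain par where par: "\<And>v. v \<in> C \<Longrightarrow> d v > 0 \<Longrightarrow> par v \<in> C \<and> adj G (par v) v \<and> d v = Suc (d (par v))"
    by metis
  have "bfs_tree G C r d par"
  proof
    show "C \<subseteq> fst G" using comps_subset[OF C] S by blast
    show "v = r" if "v \<in> C" "d v = 0" for v using ex[OF that(1)] that(2) by simp
    show "d v \<le> Suc (d u)" if "u \<in> C" "v \<in> C" "adj G u v" for u v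
    proof -
      have "(u, v) \<in> restr_adj G S" using that comps_subset[OF C] unfolding restr_adj_def by blast
      then have "(r, v) \<in> restr_adj G S ^^ Suc (d u)" using ex[OF that(1)] by auto
      then show ?thesis by (rule le)
    qed
  qed (use G par in auto)
  then show thesis by (rule that)
qed

text \<open>Short disjoint branches from \<open>x\<close> to the vertices of \<open>U\<close>. The
  centre is kept out of them because it becomes a vertex of the minor by itself; the size bound
  \<open>t\<close> limits how many branches of different fans can collide.\<close>

definition fan :: "'a sgraph \<Rightarrow> nat \<Rightarrow> 'a \<Rightarrow> 'a set \<Rightarrow> ('a \<Rightarrow> 'a set) \<Rightarrow> bool" where
  "fan G t x U P \<longleftrightarrow>
     (\<forall>u\<in>U. u \<in> P u \<and> x \<notin> P u \<and> connected_on G (P u) \<and> (\<exists>w\<in>P u. adj G x w) \<and>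
        finite (P u) \<and> card (P u) \<le> t) \<and>
     (\<forall>u\<in>U. \<forall>v\<in>U. u \<noteq> v \<longrightarrow> P u \<inter> P v = {})"

lemma fan_subset: "fan G t x U P \<Longrightarrow> U' \<subseteq> U \<Longrightarrow> fan G t x U' P"
  unfolding fan_def by (simp add: subset_iff)

lemma fan_card_hit:
  assumes "fan G t x U P" "finite U"
  shows "card {u \<in> U. w \<in> P u} \<le> 1"
proof -
  have "\<forall>u\<in>{u \<in> U. w \<in> P u}. \<forall>v\<in>{u \<in> U. w \<in> P u}. u = v"
    using assms(1) unfolding fan_def by blast
  then show ?thesis using assms(2) by (simp add: card_le_Suc0_iff_eq)
qed

text \<open>If every vertex had at most \<open>n\<close> children with descendants in
  \<open>U\<close>, level \<open>m\<close> would contain at most \<open>n ^ m\<close> ancestors of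
  \<open>U\<close>, and \<open>U\<close> would be too small. A vertex \<open>x\<close> with more
  such children is the centre, with one descendant in \<open>U\<close> chosen for each
  child.\<close>

lemma (in bfs_tree) exists_fan:
  assumes U: "finite U" "U \<subseteq> C" "card U > t * n ^ t" and "n > 0"
    and depth: "\<And>v. v \<in> C \<Longrightarrow> d v < t"
  obtains x U' P where "x \<in> C" "U' \<subseteq> U" "card U' > n" "fan G t x U' P" "\<And>u. u \<in> U' \<Longrightarrow> P u \<subseteq> C"
proof -
  \<comment> \<open>\<open>anc m u\<close> is the ancestor of \<open>u\<close> at depth
    \<open>m\<close>, possibly \<open>u\<close> itself.\<close>
  define anc where "anc = (\<lambda>m u. (par ^^ (d u - m)) u)"
  define A where "A = (\<lambda>m. anc m ` {u \<in> U. m \<le> d u})"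
  have finA: "finite (A m)" for m using U(1) by (simp add: A_def)
  have ancC: "anc m u \<in> C" "d (anc m u) = m" if "u \<in> U" "m \<le> d u" for u m
    using ancestor[of u "d u - m"] that U(2) unfolding anc_def by auto
  have par_anc: "par (anc (Suc m) u) = anc m u" if "Suc m \<le> d u" for u m
  proof -
    have "d u - m = Suc (d u - Suc m)" using that by simp
    then show ?thesis by (simp add: anc_def)
  qed
  have "\<exists>x m. card {c \<in> A (Suc m). par c = x} > n"
  proof (rule ccontr)
    assume "\<nexists>x m. card {c \<in> A (Suc m). par c = x} > n"
    then have le: "card {c \<in> A (Suc m). par c = x} \<le> n" for x m by (meson not_le)
    have cardA: "card (A m) \<le> n ^ m" for m
    proof (induction m)
      case 0
      have "A 0 \<subseteq> {r}" using ancC[of _ 0] depth_zero unfolding A_def by auto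
      then have "card (A 0) \<le> card {r}" by (intro card_mono) auto
      then show ?case by simp
    next
      case (Suc m)
      have "A (Suc m) \<subseteq> (\<Union>x\<in>A m. {c \<in> A (Suc m). par c = x})"
      proof
        fix c assume c: "c \<in> A (Suc m)"
        then obtain u where u: "u \<in> U" "Suc m \<le> d u" "c = anc (Suc m) u" unfolding A_def by blast
        then have "par c \<in> A m" using par_anc[OF u(2)] unfolding A_def by auto
        then show "c \<in> (\<Union>x\<in>A m. {c \<in> A (Suc m). par c = x})" using c by blast
      qed
      then have "card (A (Suc m)) \<le> card (\<Union>x\<in>A m. {c \<in> A (Suc m). par c = x})"
        using finA by (intro card_mono) auto
      also have "\<dots> \<le> (\<Sum>x\<in>A m. card {c \<in> A (Suc m). par c = x})" using finA by (rule card_UN_le)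
      also have "\<dots> \<le> of_nat (card (A m)) * n" using le by (intro sum_bounded_above) auto
      also have "\<dots> \<le> n ^ m * n" using Suc.IH by simp
      finally show ?case by (simp add: mult.commute)
    qed
    have "U \<subseteq> (\<Union>m<t. A m)"
    proof
      fix u assume u: "u \<in> U"
      then have "u \<in> A (d u)" unfolding A_def anc_def by force
      then show "u \<in> (\<Union>m<t. A m)" using depth u U(2) by blast
    qed
    then have "card U \<le> card (\<Union>m<t. A m)" using finA by (intro card_mono) auto
    also have "\<dots> \<le> (\<Sum>m<t. card (A m))" by (rule card_UN_le) simp
    also have "\<dots> \<le> (\<Sum>m<t. n ^ t)"
    proof (intro sum_mono)
      fix m assume "m \<in> {..<t}"
      then have "n ^ m \<le> n ^ t" using \<open>n > 0\<close> by (intro power_increasing) auto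
      then show "card (A m) \<le> n ^ t" using cardA[of m] by simp
    qed
    also have "\<dots> = t * n ^ t" by simp
    finally show False using U(3) by simp
  qed
  then obtain x m where xm: "card {c \<in> A (Suc m). par c = x} > n" by blast
  define F where "F = {c \<in> A (Suc m). par c = x}"
  have "\<forall>c\<in>F. \<exists>u. u \<in> U \<and> Suc m \<le> d u \<and> anc (Suc m) u = c" unfolding F_def A_def by blast
  then obtain f where f: "\<And>c. c \<in> F \<Longrightarrow> f c \<in> U \<and> Suc m \<le> d (f c) \<and> anc (Suc m) (f c) = c"
    by metis
  \<comment> \<open>The tree path from \<open>u\<close> up to depth \<open>m + 1\<close>, ending at
    a child of \<open>x\<close> and so stopping one step before \<open>x\<close>.\<close>
  define P where "P = (\<lambda>u. (\<lambda>i. (par ^^ i) u) ` {..d u - Suc m})"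
  have injf: "inj_on f F" using f by (metis inj_onI)
  have fu: "u \<in> U" "Suc m \<le> d u" "anc (Suc m) u \<in> F" "f (anc (Suc m) u) = u" "u \<in> C" if "u \<in> f ` F" for u
    using that f U(2) by auto
  have xC: "par c = x" "adj G x c" "x \<in> C" "d x = m" if "c \<in> F" for c
  proof -
    show p: "par c = x" using that unfolding F_def by blast
    have c: "c \<in> C" "d c = Suc m" using f[OF that] ancC by force+
    show "adj G x c" "x \<in> C" using par_adj[OF c(1)] par_in[OF c(1)] c(2) p by auto
    show "d x = m" using par_depth[OF c(1)] c(2) p by simp
  qed
  have Pd: "z \<in> C \<and> d z > m \<and> d z = d u - i" if "u \<in> f ` F" "i \<le> d u - Suc m" "z = (par ^^ i) u" for u z i
    using ancestor[OF fu(5)[OF that(1)], of i] that(2,3) fu(2)[OF that(1)] by auto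
  have "fan G t x (f ` F) P"
    unfolding fan_def
  proof (intro conjI ballI impI)
    fix u assume u: "u \<in> f ` F"
    note fu = fu[OF u]
    show "u \<in> P u" unfolding P_def by force
    show "x \<notin> P u"
    proof
      assume "x \<in> P u"
      then obtain i where "i \<le> d u - Suc m" "x = (par ^^ i) u" unfolding P_def by blast
      from Pd[OF u this] show False using xC(4)[OF fu(3)] by simp
    qed
    show "finite (P u)" unfolding P_def by simp
    have "card (P u) \<le> card {..d u - Suc m}" unfolding P_def by (rule card_image_le) simp
    then show "card (P u) \<le> t" using depth[OF fu(5)] fu(2) by simp
    have "anc (Suc m) u \<in> P u" unfolding P_def anc_def by blast
    then show "\<exists>w\<in>P u. adj G x w" using xC(2)[OF fu(3)] by blast
    show "connected_on G (P u)"
    proof (rule connected_onI)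
      fix v assume "v \<in> P u"
      then obtain i where i: "i \<le> d u - Suc m" "v = (par ^^ i) u" unfolding P_def by blast
      have "(u, (par ^^ i) u) \<in> (restr_adj G (P u))\<^sup>*" using i(1)
      proof (induction i)
        case (Suc i)
        have "adj G ((par ^^ i) u) ((par ^^ Suc i) u)"
          using ancestor_adj[OF fu(5), of i] Suc.prems fu(2) adj_sym[of G] by simp
        moreover have "(par ^^ i) u \<in> P u" "(par ^^ Suc i) u \<in> P u"
          unfolding P_def by (rule imageI, use Suc.prems in simp)+
        ultimately have "((par ^^ i) u, (par ^^ Suc i) u) \<in> restr_adj G (P u)"
          unfolding restr_adj_def by blast
        moreover have "(u, (par ^^ i) u) \<in> (restr_adj G (P u))\<^sup>*" using Suc by simp
        ultimately show ?case by (rule rtrancl_into_rtrancl[rotated])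
      qed simp
      then show "(u, v) \<in> (restr_adj G (P u))\<^sup>*" using i(2) by simp
    qed
  next
    fix u v assume u: "u \<in> f ` F" and v: "v \<in> f ` F" and "u \<noteq> v"
    show "P u \<inter> P v = {}"
    proof (rule ccontr)
      assume "P u \<inter> P v \<noteq> {}"
      then obtain i j where ij: "i \<le> d u - Suc m" "j \<le> d v - Suc m" "(par ^^ i) u = (par ^^ j) v"
        unfolding P_def by auto
      have "d u - i = d v - j" using Pd[OF u ij(1) refl] Pd[OF v ij(2) refl] ij(3) by simp
      moreover have "Suc m \<le> d u" "Suc m \<le> d v" using fu(2) u v by blast+
      \<comment> \<open>A common vertex has a single depth, so both paths need the same number
        \<open>l\<close> of further steps. They end at the same child of \<open>x\<close>, for which
        only one descendant was chosen.\<close>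
      moreover define l where "l = d u - Suc m - i"
      ultimately have l: "d u - Suc m = l + i" "d v - Suc m = l + j"
        using ij(1,2) by linarith+
      have "anc (Suc m) u = anc (Suc m) v"
        unfolding anc_def l using ij(3) by (simp add: funpow_add)
      then show False using fu(4)[OF u] fu(4)[OF v] \<open>u \<noteq> v\<close> by simp
    qed
  qed
  moreover have "F \<noteq> {}" using xm unfolding F_def by force
  then have "x \<in> C" using xC(3) by blast
  moreover have "card (f ` F) > n" using xm card_image[OF injf] unfolding F_def by simp
  moreover have "f ` F \<subseteq> U" using f by blast
  moreover have "P u \<subseteq> C" if "u \<in> f ` F" for u using Pd[OF that] unfolding P_def by auto
  ultimately show thesis using that[of x "f ` F" P] by blast
qed

section \<open>The bound on the order\<close>

text \<open>One round of the construction. The threshold is that of \<open>large_component\<close>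
  with \<open>M = t * n ^ t\<close>, the size required by \<open>exists_fan\<close>.\<close>

lemma vertex_critical_exists_fan:
  assumes G: "sgraph G" and crit: "vertex_critical G k" and free: "Pt_free t G"
    and ab: "a \<in> fst G" "b \<in> fst G" and U: "U \<subseteq> fst G" "card U > 4 * (t * n ^ t) + 2" and "n > 0"
  obtains x U' P where "x \<in> fst G - {a, b}" "U' \<subseteq> U" "card U' > n" "fan G t x U' P"
    "\<And>u. u \<in> U' \<Longrightarrow> P u \<subseteq> fst G - {a, b}"
proof -
  obtain C where C: "C \<in> comps G (fst G - {a, b})" "card (U \<inter> C) > t * n ^ t"
    using large_component[OF G crit ab U] .
  have CS: "C \<subseteq> fst G - {a, b}" using comps_subset[OF C(1)] .
  obtain r d par where "bfs_tree G C r d par"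
    using exists_bfs_tree[OF G Diff_subset C(1)] .
  then interpret bfs_tree G C r d par .
  have "finite (U \<inter> C)" by (rule card_ge_0_finite) (use C(2) in linarith)
  from this Int_lower2 C(2) \<open>n > 0\<close> depth_less[OF free] show thesis
  proof (rule exists_fan)
    fix x U' P
    assume "x \<in> C" "U' \<subseteq> U \<inter> C" "card U' > n" "fan G t x U' P"
      and "\<And>u. u \<in> U' \<Longrightarrow> P u \<subseteq> C"
    then show thesis using that[of x U' P] CS by blast
  qed
qed

text \<open>Each application of \<open>B\<close> pays for one round. Of the final
  \<open>18 * t + 3\<close>, the 3 covers branches that meet later centres, and
  \<open>18 * t\<close> covers the choice of three disjoint unions of branches.\<close>

lemma card_planar_vertex_critical:
  fixes t :: nat
  defines "B \<equiv> \<lambda>n. 4 * (t * n ^ t) + 2"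
  assumes G: "sgraph G" "planar G" "Pt_free t G" and crit: "vertex_critical G k"
  shows "card (fst G) \<le> B (B (B (18 * t + 3)))"
proof (rule ccontr)
  let ?n = "18 * t + 3"
  assume "\<not> card (fst G) \<le> B (B (B ?n))"
  then have big: "card (fst G) > B (B (B ?n))" by simp
  have pos: "B n > 0" for n by (simp add: B_def)
  note exists_fan = vertex_critical_exists_fan[OF G(1) crit G(3), folded B_def]
  have fin: "finite (fst G)" using G(1) by (simp add: sgraph_def)
  have "fst G \<noteq> {}" using big by auto
  then obtain a where a: "a \<in> fst G" by blast
  \<comment> \<open>No centre is known yet; an arbitrary vertex stands in for both deleted
    vertices.\<close>
  obtain x1 U1 P1 where 1: "x1 \<in> fst G - {a, a}" "U1 \<subseteq> fst G" "card U1 > B (B ?n)" "fan G t x1 U1 P1"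
      "\<And>u. u \<in> U1 \<Longrightarrow> P1 u \<subseteq> fst G - {a, a}"
    using exists_fan[OF a a subset_refl _ pos, of "B ?n"] big unfolding B_def by blast
  have x1: "x1 \<in> fst G" using 1 by blast
  obtain x2 U2 P2 where 2: "x2 \<in> fst G - {x1, x1}" "U2 \<subseteq> U1" "card U2 > B ?n" "fan G t x2 U2 P2"
      "\<And>u. u \<in> U2 \<Longrightarrow> P2 u \<subseteq> fst G - {x1, x1}"
    using exists_fan[OF x1 x1 1(2) _ pos, of ?n] 1(3) unfolding B_def by blast
  have x2: "x2 \<in> fst G" "U2 \<subseteq> fst G" using 1 2 by blast+
  obtain x3 U3 P3 where 3: "x3 \<in> fst G - {x1, x2}" "U3 \<subseteq> U2" "card U3 > ?n" "fan G t x3 U3 P3"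
      "\<And>u. u \<in> U3 \<Longrightarrow> P3 u \<subseteq> fst G - {x1, x2}"
    using exists_fan[OF x1 x2(1) x2(2), of ?n] 2(3) unfolding B_def by auto
  have finU: "finite U3" using fin 3(2) x2(2) finite_subset by (metis finite_subset)
  have fans: "fan G t x1 U3 P1" "fan G t x2 U3 P2" "fan G t x3 U3 P3"
    using fan_subset[OF 1(4)] fan_subset[OF 2(4)] 2(2) 3(2,4) by auto
  \<comment> \<open>Later fans avoid the earlier centres by construction, but earlier branches may
    run through later centres. Each of the three possible hits spoils at most one element.\<close>
  define U where "U = U3 - ({u \<in> U3. x2 \<in> P1 u} \<union> {u \<in> U3. x3 \<in> P1 u} \<union> {u \<in> U3. x3 \<in> P2 u})"
  define Q where "Q = (\<lambda>u. P1 u \<union> P2 u \<union> P3 u)"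
  have hits: "card (X \<union> Y \<union> Z) \<le> 3" if "card X \<le> 1" "card Y \<le> 1" "card Z \<le> 1" for X Y Z :: "'a set"
    using that card_Un_le[of X Y] card_Un_le[of "X \<union> Y" Z] by linarith
  have "card ({u \<in> U3. x2 \<in> P1 u} \<union> {u \<in> U3. x3 \<in> P1 u} \<union> {u \<in> U3. x3 \<in> P2 u}) \<le> 3"
    by (intro hits fan_card_hit[OF fans(1) finU] fan_card_hit[OF fans(2) finU])
  then have cardU: "card U > 18 * t"
    using diff_card_le_card_Diff[of "{u \<in> U3. x2 \<in> P1 u} \<union> {u \<in> U3. x3 \<in> P1 u} \<union> {u \<in> U3. x3 \<in> P2 u}" U3]
      finU 3(3) unfolding U_def by simp
  have finU': "finite U" using finU unfolding U_def by simp
  have P: "u \<in> P1 u" "u \<in> P2 u" "u \<in> P3 u" "connected_on G (P1 u)" "connected_on G (P2 u)" "connected_on G (P3 u)"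
      "card (P1 u) \<le> t" "card (P2 u) \<le> t" "card (P3 u) \<le> t" "finite (P1 u)" "finite (P2 u)" "finite (P3 u)"
      "x1 \<notin> P1 u" "x2 \<notin> P2 u" "x3 \<notin> P3 u"
      "\<exists>w\<in>P1 u. adj G x1 w" "\<exists>w\<in>P2 u. adj G x2 w" "\<exists>w\<in>P3 u. adj G x3 w" if "u \<in> U" for u
    using fans that unfolding fan_def U_def by simp_all
  define conflict where "conflict = (\<lambda>u. {v \<in> U. Q u \<inter> Q v \<noteq> {}})"
  \<comment> \<open>\<open>Q u\<close> has at most \<open>3 * t\<close> vertices, each on at most
    one branch of each of the three fans.\<close>
  have card_conflict: "card (conflict u) \<le> 9 * t" if u: "u \<in> U" for u
  proof -
    let ?H = "\<lambda>w. {v \<in> U3. w \<in> P1 v} \<union> {v \<in> U3. w \<in> P2 v} \<union> {v \<in> U3. w \<in> P3 v}"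
    have cQ: "card (Q u) \<le> 3 * t"
      using P(7,8,9)[OF u] card_Un_le[of "P1 u" "P2 u"] card_Un_le[of "P1 u \<union> P2 u" "P3 u"]
      unfolding Q_def by linarith
    have fQ: "finite (Q u)" using P(10,11,12)[OF u] unfolding Q_def by simp
    have "conflict u \<subseteq> (\<Union>w\<in>Q u. ?H w)" unfolding conflict_def U_def Q_def by blast
    then have "card (conflict u) \<le> card (\<Union>w\<in>Q u. ?H w)"
      using fQ finU by (intro card_mono) auto
    also have "\<dots> \<le> (\<Sum>w\<in>Q u. card (?H w))" using fQ by (rule card_UN_le)
    also have "\<dots> \<le> of_nat (card (Q u)) * 3"
      by (intro sum_bounded_above hits fan_card_hit[OF fans(1) finU] fan_card_hit[OF fans(2) finU]
          fan_card_hit[OF fans(3) finU])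
    also have "\<dots> \<le> 9 * t" using cQ by simp
    finally show ?thesis .
  qed
  have "U \<noteq> {}" using cardU by auto
  then obtain u1 where u1: "u1 \<in> U" by blast
  have finc: "finite (conflict u)" for u using finU' unfolding conflict_def by simp
  have "\<not> U \<subseteq> conflict u1"
    using card_mono[OF finc, of U u1] card_conflict[OF u1] cardU by linarith
  then obtain u2 where u2: "u2 \<in> U" "u2 \<notin> conflict u1" by blast
  have "\<not> U \<subseteq> conflict u1 \<union> conflict u2"
    using card_mono[of "conflict u1 \<union> conflict u2" U] finc card_conflict[OF u1] card_conflict[OF u2(1)]
      card_Un_le[of "conflict u1" "conflict u2"] cardU by force
  then obtain u3 where u3: "u3 \<in> U" "u3 \<notin> conflict u1" "u3 \<notin> conflict u2" by blast
  have dj: "Q u1 \<inter> Q u2 = {}" "Q u1 \<inter> Q u3 = {}" "Q u2 \<inter> Q u3 = {}"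
      "Q u2 \<inter> Q u1 = {}" "Q u3 \<inter> Q u1 = {}" "Q u3 \<inter> Q u2 = {}"
    using u2 u3 unfolding conflict_def by blast+
  define q where "q = (\<lambda>j::nat. Q (if j = 0 then u1 else if j = 1 then u2 else u3))"
  have q: "\<exists>u\<in>U. q j = Q u" for j using u1 u2 u3 unfolding q_def by auto
  have UU: "u \<in> U1" "u \<in> U2" "u \<in> U3" "x2 \<notin> P1 u" "x3 \<notin> P1 u" "x3 \<notin> P2 u" if "u \<in> U" for u
    using that 2(2) 3(2) unfolding U_def by blast+
  have Q: "Q u \<subseteq> fst G" "connected_on G (Q u)" "Q u \<inter> {x1, x2, x3} = {}" if u: "u \<in> U" for u
  proof -
    note s = 1(5)[OF UU(1)[OF u]] 2(5)[OF UU(2)[OF u]] 3(5)[OF UU(3)[OF u]]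
    show "Q u \<subseteq> fst G" using s unfolding Q_def by blast
    show "connected_on G (Q u)"
      unfolding Q_def using P[OF u] by (intro connected_on_Un[of _ _ _ u]) auto
    show "Q u \<inter> {x1, x2, x3} = {}"
      using s P(13,14,15)[OF u] UU[OF u] unfolding Q_def by blast
  qed
  have nb: "\<exists>w\<in>Q u. adj G y w" if "u \<in> U" "y \<in> {x1, x2, x3}" for u y
    using that(2) P(16,17,18)[OF that(1)] unfolding Q_def by blast
  show False
  proof (rule planar_no_K33_minor[OF G(1,2)])
    fix j :: nat
    obtain u where u: "u \<in> U" "q j = Q u" using q by blast
    show "q j \<subseteq> fst G" "connected_on G (q j)" "q j \<inter> {x1, x2, x3} = {}"
      unfolding u(2) by (fact Q[OF u(1)])+
    show "\<exists>w\<in>q j. adj G y w" if "y \<in> {x1, x2, x3}" for y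
      unfolding u(2) using nb[OF u(1) that] .
    show "q i \<inter> q j = {}" if "i < 3" "j < 3" "i \<noteq> j" for i
    proof -
      have "i = 0 \<or> i = 1 \<or> i = 2" "j = 0 \<or> j = 1 \<or> j = 2" using that by linarith+
      then show ?thesis
        using \<open>i \<noteq> j\<close> dj unfolding q_def by (elim disjE) simp_all
    qed
  next
    show "x1 \<in> fst G" "x2 \<in> fst G" "x3 \<in> fst G" "x1 \<noteq> x2" "x1 \<noteq> x3" "x2 \<noteq> x3"
      using x1 x2 2(1) 3(1) by blast+
  qed
qed

section \<open>Finitely many isomorphism types\<close>

lemma graph_iso_nat:
  assumes "sgraph (G :: 'a sgraph)"
  obtains H :: "nat sgraph" where "graph_iso G H" "fst H = {..<card (fst G)}"
    "snd H \<subseteq> Pow {..<card (fst G)}"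
proof -
  obtain f where f: "bij_betw f (fst G) {0..<card (fst G)}"
    using assms ex_bij_betw_finite_nat unfolding sgraph_def by blast
  then have inj: "inj_on f (fst G)" and img: "f ` fst G = {..<card (fst G)}"
    by (auto simp: bij_betw_def atLeast0LessThan)
  have sub: "e \<subseteq> fst G" if "e \<in> snd G" for e
    using sgraph_edgeE[OF assms that] by (metis empty_subsetI insert_subset)
  let ?H = "({..<card (fst G)}, (`) f ` snd G) :: nat sgraph"
  have "adj G u v \<longleftrightarrow> adj ?H (f u) (f v)" if uv: "u \<in> fst G" "v \<in> fst G" for u v
  proof
    assume "adj G u v"
    then have "f ` {u, v} \<in> (`) f ` snd G" unfolding adj_def by (rule imageI)
    then show "adj ?H (f u) (f v)" by (simp add: adj_def)
  next
    assume "adj ?H (f u) (f v)"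
    then obtain e where e: "e \<in> snd G" "f ` e = f ` {u, v}" by (auto simp: adj_def)
    then have "e = {u, v}" using inj_on_image_eq_iff[OF inj sub[OF e(1)], of "{u, v}"] uv by simp
    then show "adj G u v" using e(1) by (simp add: adj_def)
  qed
  then have "graph_iso G ?H"
    unfolding graph_iso_def using f by (auto simp: atLeast0LessThan)
  moreover have "snd ?H \<subseteq> Pow {..<card (fst G)}" using sub img by auto
  ultimately show thesis using that[of ?H] by simp
qed

theorem theorem11:
  fixes t :: nat
  assumes "t > 0"
  shows "\<exists>S :: nat sgraph set. finite S \<and>
           (\<forall>G :: 'a sgraph. sgraph G \<and> planar G \<and> Pt_free t G \<and>
               (\<exists>k>0. vertex_critical G k) \<longrightarrow> (\<exists>H\<in>S. graph_iso G H))"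
proof -
  \<comment> \<open>The bound depends on \<open>t\<close> alone, so one \<open>N\<close> serves all
    \<open>G\<close> and all \<open>k\<close>.\<close>
  obtain N where N: "\<And>(G :: 'a sgraph) k. sgraph G \<Longrightarrow> planar G \<Longrightarrow> Pt_free t G \<Longrightarrow> vertex_critical G k \<Longrightarrow>
      card (fst G) \<le> N"
    using card_planar_vertex_critical[where t = t] by blast
  \<comment> \<open>All set families on initial segments of length at most \<open>N\<close>; those
    that are not graphs do no harm to finiteness.\<close>
  define S :: "nat sgraph set" where "S = (\<Union>m\<le>N. {{..<m}} \<times> Pow (Pow {..<m}))"
  have "finite S" unfolding S_def by simp
  moreover have "\<exists>H\<in>S. graph_iso G H"
    if G: "sgraph G" "planar G" "Pt_free t G" "\<exists>k>0. vertex_critical G k" for G :: "'a sgraph"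
  proof -
    have le: "card (fst G) \<le> N" using N G by blast
    obtain H :: "nat sgraph" where H: "graph_iso G H" "fst H = {..<card (fst G)}"
        "snd H \<subseteq> Pow {..<card (fst G)}"
      using graph_iso_nat[OF G(1)] .
    have "H \<in> {{..<card (fst G)}} \<times> Pow (Pow {..<card (fst G)})"
      using H(2,3) by (simp add: mem_Times_iff)
    then have "H \<in> S" using le unfolding S_def by blast
    then show ?thesis using H(1) by blast
  qed
  ultimately show ?thesis by blast
qed

end
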